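(* Let $(a_n)_{n\ge 0}$ be a sequence of elements of a commutative algebra $R$ over the field $\mathbb{Q}(q)$ of rational functions in the indeterminate $q$, let $a_n^*=\sum_{i=0}^n{n \brack i}(-1)^i a_i q^{\binom{i}{2}}$ be its $q$-dual sequence, let $x,z$ be commuting indeterminates, and set $$A_n(y)=\sum_{i=0}^n(-1)^i{n \brack i}a_i q^{\binom{i}{2}}y^{n-i},\qquad A_n^*(y)=\sum_{i=0}^n(-1)^i{n \brack i}a_i^* y^{n-i},$$ $$A_n([1,-z,-x])=\sum_{i=0}^n(-1)^i{n \brack i}a_i q^{\binom{i}{2}}\,[1,-z,-x]^{n-i}.$$ Then for all integers $k,l\ge 0$: $$(-1)^l\sum_{j=0}^l{l \brack j}x^{l-j}\frac{A_{k+j+1}^*(z)}{[k+j+1]_q}q^{-kj-\binom{k+1}{2}}+(-1)^k\sum_{j=0}^k{k \brack j}x^{k-j}\frac{A_{l+j+1}([1,-z,-x])}{[l+j+1]_q}q^{\binom{j+1}{2}-k(l+j+1)}=\frac{a_0(-x)^{k+l+1}}{[k+l+1]_q{k+l \brack k}},$$ $$(-1)^l\sum_{j=0}^l{l \brack j}x^{l-j}A_{k+j}^*(z)\,q^{k(l-j)}=(-1)^k\sum_{j=0}^k{k \brack j}x^{k-j}A_{l+j}([1,-z,-x])\,q^{\binom{k-j}{2}},$$ $$(-1)^{l+1}\sum_{j=0}^{l+1}{l+1 \brack j}x^{l+1-j}[k+j+1]_q A_{k+j}^*(z)\, q^{(k+1)(l-j)+1}=(-1)^k\sum_{j=0}^{k+1}{k+1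 \brack j}x^{k+1-j}[l+j+1]_q A_{l+j}([1,-z,-x])\, q^{\binom{k-j}{2}-j}.$$
   Context: For an integer $k$, $[k]_q=\frac{1-q^k}{1-q}$, and $[n]_q!=[1]_q[2]_q\cdots[n]_q$ with $[0]_q!=1$. For an integer $\alpha$ and integer $k$, ${\alpha \brack k}=0$ if $k<0$, ${\alpha\brack 0}=1$, and ${\alpha \brack k}=\frac{(1-q^{\alpha})\cdots(1-q^{\alpha-k+1})}{(1-q)\cdots(1-q^k)}$ for $k\ge1$ (so ${n\brack k}=0$ for integers $0\le n<k$). For every integer $m$ (including negative $m$), $\binom{m}{2}=m(m-1)/2$. For commuting elements $u,v,w$ and $n\ge 0$: $[u,v]^n=\sum_{i=0}^n{n\brack i}u^iv^{n-i}$ and $[u,v,w]^n=\sum_{i=0}^n{n\brack i}u^i[v,w]^{n-i}=\sum_{i+j+m=n,\ i,j,m\ge0}\frac{[n]_q!}{[i]_q![j]_q![m]_q!}u^iv^jw^m$. Thus $[1,-z,-x]^m$ is the polynomial $\sum_{i+j+r=m}\frac{[m]_q!}{[i]_q![j]_q![r]_q!}(-z)^j(-x)^r$. *)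

theory Defs
  imports
    Complex_Main
    "HOL-Computational_Algebra.Polynomial"
    "HOL-Computational_Algebra.Fraction_Field"
begin

type_synonym ratfun = "rat poly fract"

definition q :: ratfun where
  "q = Fract [:0, 1:] 1"

text \<open>Commutative unital algebras over the field of rational functions in \<open>q\<close>, given by
  their scalar multiplication.\<close>

locale ratfun_algebra = vector_space scale
  for scale :: "ratfun \<Rightarrow> 'r::comm_ring_1 \<Rightarrow> 'r" +
  assumes scale_mult_assoc: "scale c (u * v) = scale c u * v"

definition qint :: "int \<Rightarrow> ratfun" where
  "qint k = (1 - q powi k) / (1 - q)"

definition qbinom :: "int \<Rightarrow> int \<Rightarrow> ratfun" where
  "qbinom \<alpha> k =
    (if k < 0 then 0
     else (\<Prod>i=1..nat k. 1 - q powi (\<alpha> - int i + 1)) / (\<Prod>i=1..nat k. 1 - q ^ i))"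

text \<open>On the integers, \<open>choose2 (-1) = 1\<close>; the division is exact.\<close>

definition choose2 :: "int \<Rightarrow> int" where
  "choose2 m = m * (m - 1) div 2"

definition qdual :: "(ratfun \<Rightarrow> 'r::comm_ring_1 \<Rightarrow> 'r) \<Rightarrow> (nat \<Rightarrow> 'r) \<Rightarrow> nat \<Rightarrow> 'r" where
  "qdual s a n =
    (\<Sum>i=0..n. s (qbinom (int n) (int i) * (-1) ^ i * q powi choose2 (int i)) (a i))"

text \<open>\<open>qpow2 s u v n\<close> is $[u,v]^n$ and \<open>qpow3 s u v w n\<close> is $[u,v,w]^n$. These are not
  powers of an element, so \<open>n\<close> is an argument.\<close>

definition qpow2 ::
    "(ratfun \<Rightarrow> 'b::comm_ring_1 \<Rightarrow> 'b) \<Rightarrow> 'b \<Rightarrow> 'b \<Rightarrow> nat \<Rightarrow> 'b" where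
  "qpow2 s u v n = (\<Sum>i=0..n. s (qbinom (int n) (int i)) (u ^ i * v ^ (n - i)))"

definition qpow3 ::
    "(ratfun \<Rightarrow> 'b::comm_ring_1 \<Rightarrow> 'b) \<Rightarrow> 'b \<Rightarrow> 'b \<Rightarrow> 'b \<Rightarrow> nat \<Rightarrow> 'b" where
  "qpow3 s u v w n = (\<Sum>i=0..n. s (qbinom (int n) (int i)) (u ^ i * qpow2 s v w (n - i)))"

text \<open>The polynomial ring $R[x,z]$ is represented as $(R[x])[z]$, so the inner
  \<open>poly\<close> carries \<open>x\<close> and the outer one \<open>z\<close>.\<close>

definition indet_x :: "'r::comm_ring_1 poly poly" where
  "indet_x = [:[:0, 1:]:]"

definition indet_z :: "'r::comm_ring_1 poly poly" where
  "indet_z = [:0, 1:]"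

definition const2 :: "'r::comm_ring_1 \<Rightarrow> 'r poly poly" where
  "const2 r = [:[:r:]:]"

definition scale2 ::
    "(ratfun \<Rightarrow> 'r::comm_ring_1 \<Rightarrow> 'r) \<Rightarrow> ratfun \<Rightarrow> 'r poly poly \<Rightarrow> 'r poly poly" where
  "scale2 s c = map_poly (map_poly (s c))"

text \<open>\<open>A_star s a n y\<close> and \<open>A_umbral s a n u v w\<close> are $A_n^*(y)$ and $A_n([u,v,w])$; the
  latter is $A_n(y)$ with each power $y^m$ replaced by $[u,v,w]^m$. Here \<open>y\<close>, \<open>u\<close>, \<open>v\<close>, \<open>w\<close> are in $R[x,z]$.\<close>

definition A_star ::
    "(ratfun \<Rightarrow> 'r::comm_ring_1 \<Rightarrow> 'r) \<Rightarrow> (nat \<Rightarrow> 'r) \<Rightarrow> nat \<Rightarrow> 'r poly poly \<Rightarrow> 'r poly poly"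
  where
  "A_star s a n y =
    (\<Sum>i=0..n. scale2 s ((-1) ^ i * qbinom (int n) (int i))
                 (const2 (qdual s a i) * y ^ (n - i)))"

definition A_umbral ::
    "(ratfun \<Rightarrow> 'r::comm_ring_1 \<Rightarrow> 'r) \<Rightarrow> (nat \<Rightarrow> 'r) \<Rightarrow> nat \<Rightarrow>
      'r poly poly \<Rightarrow> 'r poly poly \<Rightarrow> 'r poly poly \<Rightarrow> 'r poly poly"
  where
  "A_umbral s a n u v w =
    (\<Sum>i=0..n. scale2 s ((-1) ^ i * qbinom (int n) (int i) * q powi choose2 (int i))
                 (const2 (a i) * qpow3 (scale2 s) u v w (n - i)))"

end

theory Submission
  imports Defs "HOL-Computational_Algebra.Formal_Power_Series"
begin

text \<open>Write \<open>[n]\<close> for \<open>qint n\<close>. Both sides of the second identity are values at \<open>(k, l)\<close> of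
  functions \<open>X\<close> that, by the two \<open>q\<close>-Pascal rules, satisfy the same recurrence
  \<open>X (k + 1) l = - X k (l + 1) - q\<^sup>k x X k l\<close>, whatever the sequences \<open>A\<^sup>*\<close> and \<open>A\<close> are; so it
  suffices to treat \<open>k = 0\<close>. There the identity is associativity of the \<open>q\<close>-binomial convolution,
  that is, of the product of \<open>q\<close>-exponential generating functions.
  The third identity is the same statement for the sequences \<open>[n] A\<^sub>n\<^sub>-\<^sub>1\<close> at \<open>(k + 1, l + 1)\<close>,
  and the first one for \<open>A\<^sub>n\<^sub>+\<^sub>1 / [n + 1]\<close>: its right-hand side, up to a power of \<open>q\<close>,
  satisfies the recurrence as well, and it accounts for the missing term \<open>A\<^sub>0\<close> at \<open>k = 0\<close>.\<close>

subsection \<open>Gaussian binomial coefficients\<close>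

lemma q_power_eq_Fract: "q ^ n = Fract ([:0, 1:] ^ n) 1"
  by (induction n) (simp_all add: q_def One_fract_def)

lemma q_nonzero [simp]: "q \<noteq> 0"
  by (simp add: q_def Zero_fract_def eq_fract)

text \<open>Compare degrees: \<open>q\<close> is the indeterminate, so it is not a root of unity.
  Every denominator below is a product of factors \<open>1 - q ^ i\<close> with \<open>i > 0\<close>
  and hence invertible.\<close>

lemma q_power_eq_1_iff: "q ^ n = 1 \<longleftrightarrow> n = 0"
proof
  assume "q ^ n = 1"
  then have "[:0, 1::rat:] ^ n = 1"
    by (simp add: q_power_eq_Fract One_fract_def eq_fract)
  then have "degree ([:0, 1::rat:] ^ n) = 0"
    by simp
  then show "n = 0"
    by (simp add: degree_power_eq)
qed simp

lemma q_power_Suc_neq_1 [simp]: "q ^ Suc n \<noteq> 1" "q * q ^ n \<noteq> 1" "q \<noteq> 1"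
  using q_power_eq_1_iff[of "Suc n"] q_power_eq_1_iff[of 1] by auto

text \<open>The q-Pochhammer symbol, equal to \<open>(1 - q) ^ n\<close> times the q-factorial of
  \<open>n\<close>. These powers of \<open>1 - q\<close> cancel in q-binomials.\<close>

definition qpoch :: "nat \<Rightarrow> ratfun" where
  "qpoch n = (\<Prod>i=1..n. 1 - q ^ i)"

lemma qpoch_0 [simp]: "qpoch 0 = 1"
  and qpoch_Suc [simp]: "qpoch (Suc n) = (1 - q ^ Suc n) * qpoch n"
  by (simp_all add: qpoch_def mult.commute)

lemma qpoch_nonzero [simp]: "qpoch n \<noteq> 0"
  by (induction n) (simp_all del: power_Suc)

text \<open>The numerator of the q-binomial consists of the top \<open>k\<close> factors of
  \<open>qpoch n\<close>; multiplying by \<open>qpoch (n - k)\<close> supplies the others.\<close>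

lemma qbinom_eq_qpoch:
  assumes "k \<le> n"
  shows "qbinom (int n) (int k) = qpoch n / (qpoch k * qpoch (n - k))"
proof -
  have "(\<Prod>i=1..k. 1 - q powi (int n - int i + 1)) * qpoch (n - k) = qpoch n"
    using assms
  proof (induction k)
    case (Suc k)
    then have "n - k = Suc (n - Suc k)"
      by simp
    moreover have "q powi (int n - int (Suc k) + 1) = q ^ (n - k)"
      using Suc.prems by (simp flip: power_int_of_nat)
    ultimately show ?case
      using Suc by (simp add: mult_ac)
  qed simp
  then show ?thesis
    unfolding qbinom_def nat_int qpoch_def[of k, symmetric] by (simp add: eq_divide_eq mult_ac)
qed

lemma qbinom_eq_0:
  assumes "n < k"
  shows "qbinom (int n) (int k) = 0"
proof -
  have "(\<Prod>i=1..k. 1 - q powi (int n - int i + 1)) = 0"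
    \<comment> \<open>The factor at \<open>i = n + 1\<close> has exponent 0.\<close>
    using assms by (intro prod_zero bexI[of _ "Suc n"]) auto
  then show ?thesis
    by (simp add: qbinom_def)
qed

lemma qbinom_n_0 [simp]: "qbinom (int n) 0 = 1"
  by (simp add: qbinom_def)

lemma qbinom_n_n [simp]: "qbinom (int n) (int n) = 1"
  by (simp add: qbinom_eq_qpoch)

lemma qint_of_nat: "qint (int n) = (1 - q ^ n) / (1 - q)"
  by (simp add: qint_def)

lemma qint_nonzero [simp]: "qint (int (Suc n)) \<noteq> 0"
  unfolding qint_of_nat by (simp del: power_Suc)

text \<open>The two q-Pascal rules. The first drives the recurrence of \<open>dual_sum\<close>, the
  second that of \<open>umbral_sum\<close>.\<close>

lemma qbinom_Suc_Suc:
  assumes "k \<le> n"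
  shows "qbinom (int (Suc n)) (int (Suc k)) =
      qbinom (int n) (int (Suc k)) + q ^ (n - k) * qbinom (int n) (int k)"
    and "qbinom (int (Suc n)) (int (Suc k)) =
      q ^ Suc k * qbinom (int n) (int (Suc k)) + qbinom (int n) (int k)"
proof -
  have "qbinom (int (Suc n)) (int (Suc k)) =
      qbinom (int n) (int (Suc k)) + q ^ (n - k) * qbinom (int n) (int k) \<and>
    qbinom (int (Suc n)) (int (Suc k)) =
      q ^ Suc k * qbinom (int n) (int (Suc k)) + qbinom (int n) (int k)"
  proof (cases "k = n")
    case True
    then show ?thesis
      using qbinom_n_n[of "Suc n"] by (simp add: qbinom_eq_0 del: of_nat_Suc)
  next
    case False
    define d where "d = n - Suc k"
    have n: "n = Suc (k + d)"
      using False assms by (simp add: d_def)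
    \<comment> \<open>All three q-binomials are multiples of \<open>u\<close>, so the rules reduce
      to two ways of splitting \<open>1 - q ^ (k + d + 2)\<close>.\<close>
    define u where "u = qpoch n / (qpoch (Suc k) * qpoch (Suc d))"
    have 1: "qbinom (int (Suc n)) (int (Suc k)) = (1 - q ^ Suc n) * u"
      by (simp add: qbinom_eq_qpoch u_def n mult_ac del: of_nat_Suc power_Suc)
    have 2: "qbinom (int n) (int (Suc k)) = (1 - q ^ Suc d) * u"
      by (simp add: qbinom_eq_qpoch u_def n mult_ac del: of_nat_Suc power_Suc)
    have 3: "qbinom (int n) (int k) = (1 - q ^ Suc k) * u"
      by (simp add: qbinom_eq_qpoch u_def n Suc_diff_le mult_ac del: of_nat_Suc power_Suc)
    have 4: "n - k = Suc d"
      by (simp add: n)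
    show ?thesis
      unfolding 1 2 3 4 by (simp add: n algebra_simps power_add)
  qed
  then show "qbinom (int (Suc n)) (int (Suc k)) =
      qbinom (int n) (int (Suc k)) + q ^ (n - k) * qbinom (int n) (int k)"
    and "qbinom (int (Suc n)) (int (Suc k)) =
      q ^ Suc k * qbinom (int n) (int (Suc k)) + qbinom (int n) (int k)"
    by auto
qed

text \<open>The q-analogue of \<open>(k + 1) * C(n + 1, k + 1) = (n + 1) * C(n, k)\<close>. It moves
  a weight depending on the summation index out of the sum.\<close>

lemma qbinom_absorb:
  assumes "k \<le> n"
  shows "qbinom (int (Suc n)) (int (Suc k)) * qint (int (Suc k)) =
    qint (int (Suc n)) * qbinom (int n) (int k)"
  using assms by (simp add: qbinom_eq_qpoch qint_of_nat mult_ac del: of_nat_Suc power_Suc)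

lemma choose2_add_1: "choose2 (m + 1) = choose2 m + m"
proof -
  have "(m + 1) * (m + 1 - 1) = m * (m - 1) + m * 2"
    by (simp add: algebra_simps)
  then show ?thesis
    by (simp add: choose2_def)
qed

lemma choose2_diff: "choose2 (m - n) = choose2 m - m * n + choose2 (n + 1)"
proof -
  have even: "2 * choose2 i = i * (i - 1)" for i
    unfolding choose2_def by (intro dvd_mult_div_cancel) (cases "even i"; simp)
  \<comment> \<open>Doubling removes the integer division and leaves a polynomial identity, valid
    for negative arguments too.\<close>
  have "2 * choose2 (m - n) = 2 * (choose2 m - m * n + choose2 (n + 1))"
    unfolding right_diff_distrib distrib_left even by (simp add: algebra_simps)
  then show ?thesis
    by simp
qed

text \<open>Reindexing after a Pascal rule: \<open>P\<close> collects the terms that keep the lower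
  index, \<open>Q\<close> those that lower it. \<open>P (Suc n)\<close> vanishes because its
  q-binomial does.\<close>

lemma sum_pascal_split:
  fixes f P Q :: "nat \<Rightarrow> 'b::comm_monoid_add"
  assumes "f 0 = P 0" "\<And>j. j \<le> n \<Longrightarrow> f (Suc j) = P (Suc j) + Q j" "P (Suc n) = 0"
  shows "(\<Sum>j\<le>Suc n. f j) = (\<Sum>j\<le>n. P j) + (\<Sum>j\<le>n. Q j)"
proof -
  have "(\<Sum>j\<le>Suc n. f j) = P 0 + (\<Sum>j\<le>n. P (Suc j) + Q j)"
    unfolding sum.atMost_Suc_shift using assms by (intro arg_cong2[of _ _ _ _ "(+)"] sum.cong) auto
  also have "\<dots> = (\<Sum>j\<le>Suc n. P j) + (\<Sum>j\<le>n. Q j)"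
    unfolding sum.atMost_Suc_shift[of P] by (simp add: sum.distrib add.assoc)
  finally show ?thesis
    using assms(3) by simp
qed

subsection \<open>The common recurrence\<close>

text \<open>Turns scalars into ring elements, so that scalar multiplication becomes ordinary
  multiplication in a commutative ring.\<close>

locale ratfun_hom =
  fixes h :: "ratfun \<Rightarrow> 'b::comm_ring_1"
  assumes hom_1 [simp]: "h 1 = 1"
    and hom_add: "h (c + d) = h c + h d"
    and hom_mult: "h (c * d) = h c * h d"
begin

lemma hom_0 [simp]: "h 0 = 0"
  using hom_add[of 0 0] by simp

lemma hom_minus: "h (- c) = - h c"
  using hom_add[of c "- c"] by (simp add: eq_neg_iff_add_eq_0 add.commute)

lemma hom_power: "h (c ^ n) = h c ^ n"
  by (induction n) (simp_all add: hom_mult)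

lemma hom_neg_one_power [simp]: "h ((- 1) ^ n) = (- 1) ^ n"
  by (simp add: hom_power hom_minus)

definition dual_sum :: "'b \<Rightarrow> (nat \<Rightarrow> 'b) \<Rightarrow> nat \<Rightarrow> nat \<Rightarrow> 'b" where
  "dual_sum x b k l = (- 1) ^ l *
    (\<Sum>j\<le>l. h (qbinom (int l) (int j) * q powi (int k * (int l - int j))) * (x ^ (l - j) * b (k + j)))"

definition umbral_sum :: "'b \<Rightarrow> (nat \<Rightarrow> 'b) \<Rightarrow> nat \<Rightarrow> nat \<Rightarrow> 'b" where
  "umbral_sum x b k l = (- 1) ^ k *
    (\<Sum>j\<le>k. h (qbinom (int k) (int j) * q powi choose2 (int k - int j)) * (x ^ (k - j) * b (l + j)))"

text \<open>Expand the sum at \<open>(k, Suc l)\<close>. Terms keeping \<open>j\<close> carry an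
  extra \<open>q ^ k * x\<close>; in the others \<open>q ^ (l - j)\<close> raises the exponent
  \<open>k * (l - j)\<close> to \<open>(k + 1) * (l - j)\<close>.\<close>

lemma dual_sum_Suc:
  "dual_sum x b (Suc k) l = - dual_sum x b k (Suc l) - h (q ^ k) * x * dual_sum x b k l"
proof -
  let ?t = "\<lambda>k l j. h (qbinom (int l) (int j) * q powi (int k * (int l - int j))) * (x ^ (l - j) * b (k + j))"
  have "(\<Sum>j\<le>Suc l. ?t k (Suc l) j) = (\<Sum>j\<le>l. h (q ^ k) * x * ?t k l j) + (\<Sum>j\<le>l. ?t (Suc k) l j)"
  proof (rule sum_pascal_split)
    have *: "q powi (int k * (int (Suc l) - int j)) = q ^ k * q powi (int k * (int l - int j))" for j
      by (simp add: algebra_simps flip: power_int_of_nat power_int_add)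
    show "?t k (Suc l) 0 = h (q ^ k) * x * ?t k l 0"
      unfolding * by (simp add: hom_mult mult_ac del: of_nat_Suc)
    show "h (q ^ k) * x * ?t k l (Suc l) = 0"
      by (simp add: qbinom_eq_0 del: of_nat_Suc)
    fix j assume j: "j \<le> l"
    have "q powi (int k * (int (Suc l) - int (Suc j))) * q ^ (l - j) = q powi (int (Suc k) * (int l - int j))"
      using j by (simp add: algebra_simps of_nat_diff flip: power_int_of_nat power_int_add)
    then have "?t k (Suc l) (Suc j) =
        h (qbinom (int l) (int (Suc j)) * q powi (int k * (int (Suc l) - int (Suc j)))) * (x ^ (l - j) * b (k + Suc j))
        + ?t (Suc k) l j"
      unfolding qbinom_Suc_Suc(1)[OF j] by (simp add: hom_add hom_mult algebra_simps del: of_nat_Suc)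
    also have "h (qbinom (int l) (int (Suc j)) * q powi (int k * (int (Suc l) - int (Suc j)))) * (x ^ (l - j) * b (k + Suc j))
        = h (q ^ k) * x * ?t k l (Suc j)"
    \<comment> \<open>At \<open>j = l\<close> truncated subtraction spoils the match of the powers
      of \<open>x\<close>, but both sides contain a vanishing q-binomial.\<close>
    proof (cases "j = l")
      case False
      then have "l - j = Suc (l - Suc j)"
        using j by simp
      then show ?thesis
        unfolding * by (simp add: hom_mult mult_ac del: of_nat_Suc)
    qed (simp add: qbinom_eq_0 del: of_nat_Suc)
    finally show "?t k (Suc l) (Suc j) = h (q ^ k) * x * ?t k l (Suc j) + ?t (Suc k) l j" .
  qed
  then show ?thesis
    unfolding dual_sum_def sum_distrib_left[symmetric] by (simp add: algebra_simps del: of_nat_Suc sum.atMost_Suc)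
qed

text \<open>Here the sum at \<open>Suc k\<close> is expanded. The factor \<open>q ^ j\<close> of the
  second Pascal rule and the increment \<open>k - j\<close> of \<open>choose2\<close> combine to
  \<open>q ^ k\<close>.\<close>

lemma umbral_sum_Suc:
  "umbral_sum x b (Suc k) l = - umbral_sum x b k (Suc l) - h (q ^ k) * x * umbral_sum x b k l"
proof -
  let ?t = "\<lambda>k l j. h (qbinom (int k) (int j) * q powi choose2 (int k - int j)) * (x ^ (k - j) * b (l + j))"
  have "(\<Sum>j\<le>Suc k. ?t (Suc k) l j) = (\<Sum>j\<le>k. h (q ^ k) * x * ?t k l j) + (\<Sum>j\<le>k. ?t k (Suc l) j)"
  proof (rule sum_pascal_split)
    have *: "q ^ j * q powi choose2 (int (Suc k) - int j) = q ^ k * q powi choose2 (int k - int j)" for j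
      using choose2_add_1[of "int k - int j"]
      by (simp add: algebra_simps flip: power_int_of_nat power_int_add)
    show "?t (Suc k) l 0 = h (q ^ k) * x * ?t k l 0"
      using *[of 0] by (simp add: hom_mult mult_ac del: of_nat_Suc)
    show "h (q ^ k) * x * ?t k l (Suc k) = 0"
      by (simp add: qbinom_eq_0 del: of_nat_Suc)
    fix j assume j: "j \<le> k"
    have "?t (Suc k) l (Suc j) =
        h (qbinom (int k) (int (Suc j)) * (q ^ Suc j * q powi choose2 (int (Suc k) - int (Suc j)))) * (x ^ (k - j) * b (l + Suc j))
        + ?t k (Suc l) j"
      unfolding qbinom_Suc_Suc(2)[OF j] by (simp add: hom_add hom_mult algebra_simps del: power_Suc)
    also have "h (qbinom (int k) (int (Suc j)) * (q ^ Suc j * q powi choose2 (int (Suc k) - int (Suc j)))) * (x ^ (k - j) * b (l + Suc j))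
        = h (q ^ k) * x * ?t k l (Suc j)"
    proof (cases "j = k")
      case False
      then have "k - j = Suc (k - Suc j)"
        using j by simp
      then show ?thesis
        unfolding * by (simp add: hom_mult mult_ac del: of_nat_Suc)
    qed (simp add: qbinom_eq_0 del: of_nat_Suc)
    finally show "?t (Suc k) l (Suc j) = h (q ^ k) * x * ?t k l (Suc j) + ?t k (Suc l) j" .
  qed
  then show ?thesis
    unfolding umbral_sum_def sum_distrib_left[symmetric] by (simp add: algebra_simps del: of_nat_Suc sum.atMost_Suc)
qed

lemma umbral_sum_0: "umbral_sum x b 0 l = b l"
  using qbinom_n_n[of 0] by (simp add: umbral_sum_def choose2_def)

lemma dual_sum_0:
  "dual_sum x b 0 l = (- 1) ^ l * (\<Sum>j\<le>l. h (qbinom (int l) (int j)) * (x ^ (l - j) * b j))"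
  by (simp add: dual_sum_def)

text \<open>The extra term \<open>e\<close> is zero except in the first identity.\<close>

lemma dual_sum_eq_umbral_sum:
  assumes "\<And>l. dual_sum x b' 0 l = c * b l + e 0 l"
    and "\<And>k l. e (Suc k) l = - e k (Suc l) - h (q ^ k) * x * e k l"
  shows "dual_sum x b' k l = c * umbral_sum x b k l + e k l"
proof (induction k arbitrary: l)
  case 0
  show ?case
    by (simp add: assms(1) umbral_sum_0)
next
  case (Suc k)
  show ?case
    unfolding dual_sum_Suc umbral_sum_Suc assms(2) Suc.IH by (simp add: algebra_simps)
qed

subsection \<open>The \<open>q\<close>-binomial convolution\<close>

definition qconv :: "(nat \<Rightarrow> 'b) \<Rightarrow> (nat \<Rightarrow> 'b) \<Rightarrow> nat \<Rightarrow> 'b" where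
  "qconv u v n = (\<Sum>i\<le>n. h (qbinom (int n) (int i)) * (u i * v (n - i)))"

text \<open>The q-exponential generating function, with \<open>qpoch n\<close> in place of the
  q-factorial, which only rescales the variable.\<close>

definition qegf :: "(nat \<Rightarrow> 'b) \<Rightarrow> 'b fps" where
  "qegf u = Abs_fps (\<lambda>n. h (1 / qpoch n) * u n)"

lemma qegf_qconv: "qegf (qconv u v) = qegf u * qegf v"
proof (rule fps_ext)
  fix n
  have "h (1 / qpoch n) * (h (qbinom (int n) (int i)) * (u i * v (n - i))) =
      (h (1 / qpoch i) * u i) * (h (1 / qpoch (n - i)) * v (n - i))" if "i \<le> n" for i
  proof -
    have "h (1 / qpoch n) * h (qbinom (int n) (int i)) = h (1 / qpoch i) * h (1 / qpoch (n - i))"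
      using that by (simp add: qbinom_eq_qpoch flip: hom_mult)
    from arg_cong[OF this, of "\<lambda>t. t * (u i * v (n - i))"] show ?thesis
      by (simp add: mult_ac)
  qed
  then show "fps_nth (qegf (qconv u v)) n = fps_nth (qegf u * qegf v) n"
    unfolding qegf_def qconv_def fps_mult_nth atMost_atLeast0 fps_nth_Abs_fps sum_distrib_left
    by (intro sum.cong) simp_all
qed

text \<open>The image of \<open>qpoch n\<close> under \<open>h\<close> is a unit, so it cancels even
  if the ring has zero divisors.\<close>

lemma qegf_inject: "qegf u = qegf v \<Longrightarrow> u = v"
proof
  fix n assume "qegf u = qegf v"
  then have "fps_nth (qegf u) n = fps_nth (qegf v) n"
    by simp
  then have "h (qpoch n) * h (1 / qpoch n) * u n = h (qpoch n) * h (1 / qpoch n) * v n"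
    by (simp add: qegf_def mult.assoc)
  then show "u n = v n"
    by (simp flip: hom_mult)
qed

lemma qconv_assoc: "qconv (qconv u v) w = qconv u (qconv v w)"
  by (rule qegf_inject) (simp add: qegf_qconv mult.assoc)

lemma qconv_neg_one_power:
  "(- 1) ^ n * qconv u v n = qconv (\<lambda>i. (- 1) ^ i * u i) (\<lambda>i. (- 1) ^ i * v i) n"
  unfolding qconv_def sum_distrib_left
proof (rule sum.cong)
  fix i assume "i \<in> {..n}"
  then have "(- 1 :: 'b) ^ n = (- 1) ^ i * (- 1) ^ (n - i)"
    by (simp flip: power_add)
  then show "(- 1) ^ n * (h (qbinom (int n) (int i)) * (u i * v (n - i))) =
      h (qbinom (int n) (int i)) * ((- 1) ^ i * u i * ((- 1) ^ (n - i) * v (n - i)))"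
    by (simp add: mult_ac)
qed simp

text \<open>With \<open>b\<close> the signed, weighted sequence,
  \<open>qconv b (\<lambda>_. 1)\<close> is its q-dual and \<open>d\<close> is
  \<open>A_star\<close>. Distributing \<open>(- 1) ^ l\<close> over the convolutions negates
  \<open>x\<close> and \<open>y\<close>; associativity then assembles
  \<open>[1, -y, -x]\<close>.\<close>

lemma qconv_dual:
  fixes y x :: 'b and b :: "nat \<Rightarrow> 'b"
  defines "d \<equiv> qconv (\<lambda>i. (- 1) ^ i * qconv b (\<lambda>_. 1) i) ((^) y)"
  shows "dual_sum x d 0 l = qconv b (qconv (\<lambda>_. 1) (qconv ((^) (- y)) ((^) (- x)))) l"
proof -
  have neg: "(\<lambda>i. (- 1) ^ i * v ^ i) = (^) (- v)" for v :: 'b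
    by (rule ext) (simp flip: power_mult_distrib)
  have "dual_sum x d 0 l = (- 1) ^ l * qconv d ((^) x) l"
    by (simp add: dual_sum_0 qconv_def mult_ac)
  also have "\<dots> = qconv (\<lambda>j. (- 1) ^ j * d j) ((^) (- x)) l"
    by (simp add: qconv_neg_one_power neg)
  \<comment> \<open>The sign in \<open>d\<close> cancels against the distributed one, leaving the
    dual sequence unsigned.\<close>
  also have "(\<lambda>j. (- 1) ^ j * d j) = qconv (qconv b (\<lambda>_. 1)) ((^) (- y))"
    by (rule ext) (simp add: d_def qconv_neg_one_power neg flip: mult.assoc power_add)
  finally show ?thesis
    by (simp add: qconv_assoc)
qed

subsection \<open>The three identities for an abstract dual pair\<close>

context
  fixes x :: 'b and A' A :: "nat \<Rightarrow> 'b"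
  assumes dual: "\<And>l. dual_sum x A' 0 l = A l"
begin

lemma dual_identity: "dual_sum x A' k l = umbral_sum x A k l"
  using dual_sum_eq_umbral_sum[of x A' 1 A "\<lambda>_ _. 0" k l] dual by simp

text \<open>At \<open>k = 0\<close>, absorption replaces the weight \<open>[j]\<close> by
  \<open>[l]\<close> and leaves the assumed relation at \<open>l - 1\<close>; the change in
  \<open>(- 1) ^ l\<close> gives the minus sign. At \<open>n = 0\<close> the weight
  \<open>[0] = 0\<close> removes the truncated index \<open>n - 1\<close>.\<close>

lemma dual_identity_derivative:
  "dual_sum x (\<lambda>n. h (qint (int n)) * A' (n - 1)) k l =
    - umbral_sum x (\<lambda>n. h (qint (int n)) * A (n - 1)) k l"
proof -
  have "dual_sum x (\<lambda>n. h (qint (int n)) * A' (n - 1)) 0 l = - (h (qint (int l)) * A (l - 1))" for l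
  proof (cases l)
    case (Suc m)
    have "h (qbinom (int (Suc m)) (int (Suc j))) * (x ^ (Suc m - Suc j) * (h (qint (int (Suc j))) * A' j)) =
        h (qint (int (Suc m))) * (h (qbinom (int m) (int j)) * (x ^ (m - j) * A' j))" if "j \<le> m" for j
    proof -
      have "h (qbinom (int (Suc m)) (int (Suc j))) * h (qint (int (Suc j))) =
          h (qint (int (Suc m))) * h (qbinom (int m) (int j))"
        using qbinom_absorb[OF that] by (simp flip: hom_mult)
      from arg_cong[OF this, of "\<lambda>t. t * (x ^ (m - j) * A' j)"] show ?thesis
        by (simp add: mult_ac del: of_nat_Suc)
    qed
    then have "dual_sum x (\<lambda>n. h (qint (int n)) * A' (n - 1)) 0 (Suc m) =
        (- 1) ^ Suc m * (\<Sum>j\<le>m. h (qint (int (Suc m))) * (h (qbinom (int m) (int j)) * (x ^ (m - j) * A' j)))"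
      unfolding dual_sum_0 sum.atMost_Suc_shift by (simp add: qint_def del: of_nat_Suc)
    also have "\<dots> = - (h (qint (int (Suc m))) * A m)"
      unfolding dual[symmetric] dual_sum_0 sum_distrib_left[symmetric] by (simp add: mult_ac del: of_nat_Suc)
    finally show ?thesis
      by (simp add: Suc)
  qed (simp add: dual_sum_0 qint_def)
  then show ?thesis
    using dual_sum_eq_umbral_sum[of x _ "- 1" "\<lambda>n. h (qint (int n)) * A (n - 1)" "\<lambda>_ _. 0" k l] by simp
qed

text \<open>At \<open>k = 0\<close>, absorption in reverse gives the assumed relation at
  \<open>l + 1\<close> without its term \<open>j = 0\<close>. That term is the initial value of the
  correction.\<close>

lemma dual_identity_integral:
  "dual_sum x (\<lambda>n. h (1 / qint (int (Suc n))) * A' (Suc n)) k l =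
    - umbral_sum x (\<lambda>n. h (1 / qint (int (Suc n))) * A (Suc n)) k l +
    h (q powi (int k * int l + choose2 (int k + 1)) / (qint (int (k + l + 1)) * qbinom (int (k + l)) (int k))) *
      (A' 0 * (- x) ^ (k + l + 1))"
proof -
  \<comment> \<open>Apart from the power of \<open>q\<close>, this is a q-beta value
    \<open>[k]! [l]! / [k + l + 1]!\<close>; the power of \<open>q\<close> makes
    \<open>c_rec\<close> hold.\<close>
  define c where "c k l = q powi (int k * int l + choose2 (int k + 1)) /
    (qint (int (k + l + 1)) * qbinom (int (k + l)) (int k))" for k l
  have c: "c k l = q powi (int k * int l + choose2 (int k + 1)) * (1 - q) * qpoch k * qpoch l / qpoch (Suc (k + l))" for k l
    by (simp add: c_def qbinom_eq_qpoch qint_of_nat field_simps del: of_nat_Suc of_nat_add)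
  have "choose2 (int (Suc k) + 1) = choose2 (int k + 1) + int k + 1" for k
    using choose2_add_1[of "int k + 1"] by (simp add: add_ac)
  then have pow: "q powi (int (Suc k) * int l + choose2 (int (Suc k) + 1)) =
      q ^ k * q ^ Suc l * q powi (int k * int l + choose2 (int k + 1))"
    "q powi (int k * int (Suc l) + choose2 (int k + 1)) = q ^ k * q powi (int k * int l + choose2 (int k + 1))" for k l
    by (simp_all add: algebra_simps flip: power_int_of_nat power_int_add)
  have c_rec: "c (Suc k) l = - c k (Suc l) + q ^ k * c k l" for k l
  proof -
    \<comment> \<open>Over the common factor \<open>u\<close>, and after cancelling
      \<open>q ^ k\<close>, the recurrence says \<open>q ^ (l+1) * (1 - q ^ (k+1)) = (1 - q ^
      (k+l+2)) - (1 - q ^ (l+1))\<close>.\<close>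
    define u where "u = q powi (int k * int l + choose2 (int k + 1)) * (1 - q) * qpoch k * qpoch l / qpoch (Suc (Suc (k + l)))"
    have 1: "c (Suc k) l = q ^ k * q ^ Suc l * (1 - q ^ Suc k) * u" "c k (Suc l) = q ^ k * (1 - q ^ Suc l) * u"
      unfolding c pow u_def by (simp_all add: mult_ac del: power_Suc)
    have 2: "c k l = (1 - q ^ Suc (Suc (k + l))) * u"
      unfolding c u_def qpoch_Suc[of "Suc (k + l)"] by (simp add: mult_ac del: power_Suc qpoch_Suc)
    show ?thesis
      unfolding 1 2 by (simp add: algebra_simps power_add)
  qed
  define e where "e k l = h (c k l) * (A' 0 * (- x) ^ (k + l + 1))" for k l
  \<comment> \<open>The plus sign in \<open>c_rec\<close> becomes a minus through the additional
    factor \<open>- x\<close>.\<close>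
  have "e (Suc k) l = - e k (Suc l) - h (q ^ k) * x * e k l" for k l
    unfolding e_def c_rec hom_add hom_mult hom_minus by (simp add: algebra_simps)
  moreover have "dual_sum x (\<lambda>n. h (1 / qint (int (Suc n))) * A' (Suc n)) 0 l =
      - 1 * (h (1 / qint (int (Suc l))) * A (Suc l)) + e 0 l" for l
  proof -
    have "h (qbinom (int l) (int j)) * (x ^ (l - j) * (h (1 / qint (int (Suc j))) * A' (Suc j))) =
        h (1 / qint (int (Suc l))) * (h (qbinom (int (Suc l)) (int (Suc j))) * (x ^ (Suc l - Suc j) * A' (Suc j)))" if "j \<le> l" for j
    proof -
      have "qbinom (int l) (int j) * (1 / qint (int (Suc j))) =
          1 / qint (int (Suc l)) * qbinom (int (Suc l)) (int (Suc j))"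
        using qbinom_absorb[OF that] by (simp add: field_simps del: of_nat_Suc)
      then have "h (qbinom (int l) (int j)) * h (1 / qint (int (Suc j))) =
          h (1 / qint (int (Suc l))) * h (qbinom (int (Suc l)) (int (Suc j)))"
        by (simp flip: hom_mult)
      from arg_cong[OF this, of "\<lambda>t. t * (x ^ (l - j) * A' (Suc j))"] show ?thesis
        by (simp add: mult_ac del: of_nat_Suc)
    qed
    then have 1: "dual_sum x (\<lambda>n. h (1 / qint (int (Suc n))) * A' (Suc n)) 0 l =
        (- 1) ^ l * (h (1 / qint (int (Suc l))) *
          (\<Sum>j\<le>l. h (qbinom (int (Suc l)) (int (Suc j))) * (x ^ (Suc l - Suc j) * A' (Suc j))))"
      unfolding dual_sum_0 by (simp add: sum_distrib_left del: of_nat_Suc)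
    have 2: "A (Suc l) = (- x) ^ Suc l * A' 0 - (- 1) ^ l *
        (\<Sum>j\<le>l. h (qbinom (int (Suc l)) (int (Suc j))) * (x ^ (Suc l - Suc j) * A' (Suc j)))"
      unfolding dual[symmetric] dual_sum_0 sum.atMost_Suc_shift
      by (simp add: algebra_simps power_minus[of x] del: of_nat_Suc)
    have 3: "e 0 l = h (1 / qint (int (Suc l))) * (A' 0 * (- x) ^ Suc l)"
      by (simp add: e_def c_def choose2_def)
    show ?thesis
      unfolding 1 2 3 by (simp add: algebra_simps del: of_nat_Suc)
  qed
  ultimately have "dual_sum x (\<lambda>n. h (1 / qint (int (Suc n))) * A' (Suc n)) k l =
      - 1 * umbral_sum x (\<lambda>n. h (1 / qint (int (Suc n))) * A (Suc n)) k l + e k l"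
    by (intro dual_sum_eq_umbral_sum)
  then show ?thesis
    by (simp add: e_def c_def)
qed

end

end

subsection \<open>Specialisation to the polynomial ring\<close>

lemma const2_add: "const2 (u + v) = const2 u + const2 v"
  and const2_mult: "const2 (u * v) = const2 u * const2 v"
  by (simp_all add: const2_def)

lemma const2_sum: "const2 (\<Sum>i\<in>I. f i) = (\<Sum>i\<in>I. const2 (f i))"
  by (induction I rule: infinite_finite_induct) (simp_all add: const2_add, simp_all add: const2_def)

context ratfun_algebra
begin

definition const_scale :: "ratfun \<Rightarrow> 'r poly poly" where
  "const_scale c = const2 (scale c 1)"

lemma scale_eq_mult: "scale c u = scale c 1 * u"
  using scale_mult_assoc[of c 1 u] by simp

lemma scale2_eq_mult: "scale2 scale c p = const_scale c * p"
proof -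
  have "map_poly (scale c) p = smult (scale c 1) p" for p
    by (rule poly_eqI) (simp add: coeff_map_poly scale_mult_assoc flip: scale_eq_mult)
  then have "map_poly (scale c) = smult (scale c 1)"
    by blast
  then show ?thesis
    by (simp add: scale2_def const_scale_def const2_def)
       (rule poly_eqI, simp add: coeff_map_poly)
qed

lemma const2_scale: "const2 (scale c u) = const_scale c * const2 u"
  unfolding const_scale_def const2_mult[symmetric] by (simp flip: scale_eq_mult)

sublocale hom: ratfun_hom const_scale
proof
  show "const_scale 1 = 1"
    by (simp add: const_scale_def const2_def flip: one_pCons)
  fix c d
  show "const_scale (c + d) = const_scale c + const_scale d"
    by (simp add: const_scale_def scale_left_distrib const2_add)
  show "const_scale (c * d) = const_scale c * const_scale d"
    by (simp add: const_scale_def flip: const2_mult scale_eq_mult)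
qed

abbreviation "qseq a i \<equiv> const_scale ((- 1) ^ i * q powi choose2 (int i)) * const2 (a i)"

lemma const2_qdual: "const2 (qdual scale a n) = hom.qconv (qseq a) (\<lambda>_. 1) n"
  by (simp add: qdual_def hom.qconv_def const2_sum const2_scale hom.hom_mult mult_ac atMost_atLeast0)

lemma A_star_eq_qconv:
  "A_star scale a n y = hom.qconv (\<lambda>i. (- 1) ^ i * const2 (qdual scale a i)) ((^) y) n"
  by (simp add: A_star_def hom.qconv_def scale2_eq_mult hom.hom_mult mult_ac atMost_atLeast0)

text \<open>Since the first argument is 1, its powers form the constant sequence, and
  \<open>[1, v, w]\<close> is an iterated convolution.\<close>

lemma A_umbral_eq_qconv:
  "A_umbral scale a n 1 v w = hom.qconv (qseq a) (hom.qconv (\<lambda>_. 1) (hom.qconv ((^) v) ((^) w))) n"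
  by (simp add: A_umbral_def qpow3_def qpow2_def hom.qconv_def scale2_eq_mult hom.hom_mult mult_ac
      atMost_atLeast0)

lemma A_star_dual:
  "hom.dual_sum x (\<lambda>n. A_star scale a n z) 0 l = A_umbral scale a l 1 (- z) (- x)"
  unfolding A_star_eq_qconv A_umbral_eq_qconv const2_qdual by (rule hom.qconv_dual)

lemma A_star_0: "A_star scale a 0 z = const2 (a 0)"
  using qbinom_n_0[of 0] by (simp add: A_star_eq_qconv const2_qdual hom.qconv_def choose2_def)

lemma scaled_dual_sum:
  "const_scale c * hom.dual_sum x b k l = (- 1) ^ l *
    (\<Sum>j=0..l. const_scale (c * (qbinom (int l) (int j) * q powi (int k * (int l - int j)))) *
      (x ^ (l - j) * b (k + j)))"
  by (simp add: hom.dual_sum_def atMost_atLeast0 hom.hom_mult mult_ac sum_distrib_left)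

lemma scaled_umbral_sum:
  "const_scale c * hom.umbral_sum x b k l = (- 1) ^ k *
    (\<Sum>j=0..k. const_scale (c * (qbinom (int k) (int j) * q powi choose2 (int k - int j))) *
      (x ^ (k - j) * b (l + j)))"
  by (simp add: hom.umbral_sum_def atMost_atLeast0 hom.hom_mult mult_ac sum_distrib_left)

lemma integral_identity:
  "(- 1) ^ l *
     (\<Sum>j=0..l. scale2 scale (qbinom (int l) (int j) / qint (int (k + j + 1))
                             * q powi (- int k * int j - choose2 (int k + 1)))
                  (x ^ (l - j) * A_star scale a (k + j + 1) z))
   + (- 1) ^ k *
     (\<Sum>j=0..k. scale2 scale (qbinom (int k) (int j) / qint (int (l + j + 1))
                             * q powi (choose2 (int j + 1) - int k * int (l + j + 1)))
                  (x ^ (k - j) * A_umbral scale a (l + j + 1) 1 (- z) (- x)))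
   = scale2 scale (1 / (qint (int (k + l + 1)) * qbinom (int (k + l)) (int k)))
       (const2 (a 0) * (- x) ^ (k + l + 1))" (is "?D + ?U = ?E")
proof -
  \<comment> \<open>The exponent of \<open>q\<close> in the correction term. Multiplying by
    \<open>q powi (- m)\<close> clears it and yields the exponents of both sums.\<close>
  define m where "m = int k * int l + choose2 (int k + 1)"
  have D: "const_scale (q powi (- m)) * hom.dual_sum x
      (\<lambda>n. const_scale (1 / qint (int (Suc n))) * A_star scale a (Suc n) z) k l = ?D"
    unfolding scaled_dual_sum
  proof (intro arg_cong[where f = "(*) _"] sum.cong refl)
    fix j
    have "q powi (- m) * q powi (int k * (int l - int j)) = q powi (- int k * int j - choose2 (int k + 1))"
      unfolding power_int_add[OF disjI1, OF q_nonzero, symmetric]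
      by (simp add: m_def right_diff_distrib minus_diff_commute)
    then have "qbinom (int l) (int j) / qint (int (k + j + 1)) * q powi (- int k * int j - choose2 (int k + 1)) =
        q powi (- m) * (qbinom (int l) (int j) * q powi (int k * (int l - int j))) * (1 / qint (int (Suc (k + j))))"
      by (simp add: algebra_simps del: of_nat_Suc)
    then show "const_scale (q powi (- m) * (qbinom (int l) (int j) * q powi (int k * (int l - int j)))) *
        (x ^ (l - j) * (const_scale (1 / qint (int (Suc (k + j)))) * A_star scale a (Suc (k + j)) z)) =
      scale2 scale (qbinom (int l) (int j) / qint (int (k + j + 1)) * q powi (- int k * int j - choose2 (int k + 1)))
        (x ^ (l - j) * A_star scale a (k + j + 1) z)"
      unfolding scale2_eq_mult by (simp only: hom.hom_mult mult_ac Suc_eq_plus1 add_ac)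
  qed
  have U: "const_scale (q powi (- m)) * hom.umbral_sum x
      (\<lambda>n. const_scale (1 / qint (int (Suc n))) * A_umbral scale a (Suc n) 1 (- z) (- x)) k l = ?U"
    unfolding scaled_umbral_sum
  proof (intro arg_cong[where f = "(*) _"] sum.cong refl)
    fix j
    have "q powi (- m) * q powi choose2 (int k - int j) = q powi (choose2 (int j + 1) - int k * int (l + j + 1))"
      unfolding m_def choose2_add_1[of "int k"] choose2_diff by (simp add: algebra_simps flip: power_int_add)
    then have "qbinom (int k) (int j) / qint (int (l + j + 1)) * q powi (choose2 (int j + 1) - int k * int (l + j + 1)) =
        q powi (- m) * (qbinom (int k) (int j) * q powi choose2 (int k - int j)) * (1 / qint (int (Suc (l + j))))"
      by (simp add: algebra_simps del: of_nat_Suc)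
    then show "const_scale (q powi (- m) * (qbinom (int k) (int j) * q powi choose2 (int k - int j))) *
        (x ^ (k - j) * (const_scale (1 / qint (int (Suc (l + j)))) * A_umbral scale a (Suc (l + j)) 1 (- z) (- x))) =
      scale2 scale (qbinom (int k) (int j) / qint (int (l + j + 1)) * q powi (choose2 (int j + 1) - int k * int (l + j + 1)))
        (x ^ (k - j) * A_umbral scale a (l + j + 1) 1 (- z) (- x))"
      unfolding scale2_eq_mult by (simp only: hom.hom_mult mult_ac Suc_eq_plus1 add_ac)
  qed
  have E: "const_scale (q powi (- m)) *
      (const_scale (q powi m / (qint (int (k + l + 1)) * qbinom (int (k + l)) (int k))) *
        (A_star scale a 0 z * (- x) ^ (k + l + 1))) = ?E"
  proof -
    have *: "q powi (- m) * (q powi m / (qint (int (k + l + 1)) * qbinom (int (k + l)) (int k))) =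
        1 / (qint (int (k + l + 1)) * qbinom (int (k + l)) (int k))"
      by (simp add: power_int_minus)
    show ?thesis
      unfolding scale2_eq_mult A_star_0 *[symmetric] by (simp only: hom.hom_mult mult.assoc)
  qed
  have "?D = ?E - ?U"
    unfolding D[symmetric] U[symmetric] E[symmetric] m_def
    unfolding hom.dual_identity_integral[of x "\<lambda>n. A_star scale a n z", OF A_star_dual]
    by (simp only: uminus_add_conv_diff right_diff_distrib)
  then show ?thesis
    by (simp only: eq_diff_eq)
qed

lemma duality_identity:
  "(- 1) ^ l *
     (\<Sum>j=0..l. scale2 scale (qbinom (int l) (int j) * q powi (int k * (int l - int j)))
                  (x ^ (l - j) * A_star scale a (k + j) z))
   = (- 1) ^ k *
     (\<Sum>j=0..k. scale2 scale (qbinom (int k) (int j) * q powi choose2 (int k - int j))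
                  (x ^ (k - j) * A_umbral scale a (l + j) 1 (- z) (- x)))"
  using hom.dual_identity[of x "\<lambda>n. A_star scale a n z", OF A_star_dual, of k l]
  by (simp add: hom.dual_sum_def hom.umbral_sum_def scale2_eq_mult atMost_atLeast0)

text \<open>The abstract identity at \<open>(k + 1, l + 1)\<close>, multiplied by
  \<open>q powi (- int k)\<close> to normalise the exponents.\<close>

lemma derivative_identity:
  "(- 1) ^ (l + 1) *
     (\<Sum>j=0..l+1. scale2 scale (qbinom (int (l + 1)) (int j) * qint (int (k + j + 1))
                               * q powi ((int k + 1) * (int l - int j) + 1))
                    (x ^ (l + 1 - j) * A_star scale a (k + j) z))
   = (- 1) ^ k *
     (\<Sum>j=0..k+1. scale2 scale (qbinom (int (k + 1)) (int j) * qint (int (l + j + 1))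
                               * q powi (choose2 (int k - int j) - int j))
                    (x ^ (k + 1 - j) * A_umbral scale a (l + j) 1 (- z) (- x)))" (is "?D = _ * ?U")
proof -
  have D: "const_scale (q powi (- int k)) * hom.dual_sum x
      (\<lambda>n. const_scale (qint (int n)) * A_star scale a (n - 1) z) (k + 1) (l + 1) = ?D"
    unfolding scaled_dual_sum
  proof (intro arg_cong[where f = "(*) _"] sum.cong refl)
    fix j
    have *: "q powi (- int k) * q powi (int (k + 1) * (int (l + 1) - int j)) =
        q powi ((int k + 1) * (int l - int j) + 1)"
      by (simp add: algebra_simps flip: power_int_add)
    show "const_scale (q powi (- int k) * (qbinom (int (l + 1)) (int j) * q powi (int (k + 1) * (int (l + 1) - int j)))) *
        (x ^ (l + 1 - j) * (const_scale (qint (int (k + 1 + j))) * A_star scale a (k + 1 + j - 1) z)) =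
      scale2 scale (qbinom (int (l + 1)) (int j) * qint (int (k + j + 1)) * q powi ((int k + 1) * (int l - int j) + 1))
        (x ^ (l + 1 - j) * A_star scale a (k + j) z)"
      unfolding scale2_eq_mult *[symmetric] hom.hom_mult by (simp add: mult_ac add_ac)
  qed
  have U: "const_scale (q powi (- int k)) * hom.umbral_sum x
      (\<lambda>n. const_scale (qint (int n)) * A_umbral scale a (n - 1) 1 (- z) (- x)) (k + 1) (l + 1) =
      (- 1) ^ (k + 1) * ?U"
    unfolding scaled_umbral_sum
  proof (intro arg_cong[where f = "(*) _"] sum.cong refl)
    fix j
    \<comment> \<open>Integer arguments matter: at \<open>j = k + 1\<close> this reads
      \<open>choose2 0 = choose2 (- 1) - 1\<close>, with \<open>choose2 (- 1) = 1\<close>.\<close>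
    have "choose2 (int (k + 1) - int j) = choose2 (int k - int j) + (int k - int j)"
      using choose2_add_1[of "int k - int j"] by (simp add: algebra_simps)
    then have *: "q powi (- int k) * q powi choose2 (int (k + 1) - int j) = q powi (choose2 (int k - int j) - int j)"
      by (simp flip: power_int_add)
    show "const_scale (q powi (- int k) * (qbinom (int (k + 1)) (int j) * q powi choose2 (int (k + 1) - int j))) *
        (x ^ (k + 1 - j) * (const_scale (qint (int (l + 1 + j))) * A_umbral scale a (l + 1 + j - 1) 1 (- z) (- x))) =
      scale2 scale (qbinom (int (k + 1)) (int j) * qint (int (l + j + 1)) * q powi (choose2 (int k - int j) - int j))
        (x ^ (k + 1 - j) * A_umbral scale a (l + j) 1 (- z) (- x))"
      unfolding scale2_eq_mult *[symmetric] hom.hom_mult by (simp add: mult_ac add_ac)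
  qed
  have "?D = - ((- 1) ^ (k + 1) * ?U)"
    unfolding D[symmetric] U[symmetric]
    unfolding hom.dual_identity_derivative[of x "\<lambda>n. A_star scale a n z", OF A_star_dual]
    by (simp only: mult_minus_right)
  then show ?thesis
    by simp
qed

end

theorem theorem2:
  fixes s :: "ratfun \<Rightarrow> 'r::comm_ring_1 \<Rightarrow> 'r"
    and a :: "nat \<Rightarrow> 'r"
    and x z :: "'r poly poly"
    and k l :: nat
  assumes "ratfun_algebra s"
    and "x = indet_x" and "z = indet_z"
  shows
    "((-1) ^ l *
       (\<Sum>j=0..l. scale2 s (qbinom (int l) (int j) / qint (int (k + j + 1))
                               * q powi (- int k * int j - choose2 (int k + 1)))
                    (x ^ (l - j) * A_star s a (k + j + 1) z))
     + (-1) ^ k *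
       (\<Sum>j=0..k. scale2 s (qbinom (int k) (int j) / qint (int (l + j + 1))
                               * q powi (choose2 (int j + 1) - int k * int (l + j + 1)))
                    (x ^ (k - j) * A_umbral s a (l + j + 1) 1 (- z) (- x)))
     = scale2 s (1 / (qint (int (k + l + 1)) * qbinom (int (k + l)) (int k)))
         (const2 (a 0) * (- x) ^ (k + l + 1)))
     \<and>
    ((-1) ^ l *
       (\<Sum>j=0..l. scale2 s (qbinom (int l) (int j) * q powi (int k * (int l - int j)))
                    (x ^ (l - j) * A_star s a (k + j) z))
     = (-1) ^ k *
       (\<Sum>j=0..k. scale2 s (qbinom (int k) (int j) * q powi choose2 (int k - int j))
                    (x ^ (k - j) * A_umbral s a (l + j) 1 (- z) (- x))))
     \<and>
    ((-1) ^ (l + 1) *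
       (\<Sum>j=0..l+1. scale2 s (qbinom (int (l + 1)) (int j) * qint (int (k + j + 1))
                                 * q powi ((int k + 1) * (int l - int j) + 1))
                      (x ^ (l + 1 - j) * A_star s a (k + j) z))
     = (-1) ^ k *
       (\<Sum>j=0..k+1. scale2 s (qbinom (int (k + 1)) (int j) * qint (int (l + j + 1))
                                 * q powi (choose2 (int k - int j) - int j))
                      (x ^ (k + 1 - j) * A_umbral s a (l + j) 1 (- z) (- x))))"
proof -
  interpret ratfun_algebra s
    by fact
  show ?thesis
    by (intro conjI integral_identity duality_identity derivative_identity)
qed

end
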